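(* For every $n\geq 0$ and every $P\in\mathcal{D}_n^{h,\geq}$, $$\#DDU(P)=\#DF(\phi(P))+\#DU(\phi(P))+\#FUU(\phi(P))+\#FUF(\phi(P)).$$
   Context: A Motzkin path of length $n$ is a word in the steps $U=(1,1)$, $D=(1,-1)$, $F=(1,0)$ forming a lattice path from $(0,0)$ to $(n,0)$ never going below the $x$-axis; $\mathcal{M}_n$ is the set of them. A Dyck path of semilength $n$ is a Motzkin path of length $2n$ without $F$ steps. Every nonempty Dyck path has a unique first return decomposition $P=U\alpha D\beta$ with $\alpha,\beta$ Dyck paths; $h$ denotes maximal height. $\mathcal{D}^{h,\geq}$ is defined recursively: it contains the empty path $\epsilon$, and $P=U\alpha D\beta$ belongs to it iff $\alpha,\beta\in\mathcal{D}^{h,\geq}$ and $h(U\alpha D)\geq h(\beta)$; $\mathcal{D}_n^{h,\geq}$ is the subset of semilength $n$. The bijection $\phi:\mathcal{D}_n^{h,\geq}\to\mathcal{M}_n$ is defined by $\phi(\epsilon)=\epsilon$, $\phi(\alpha UD)=\phi(\alpha)F$, $\phi(\alpha UU\beta D\gamma D)=\phi(\alpha)\phi(\gamma)U\phi(\beta)D$. For a word $X$, $\#X(P)$ is the number of occurrences of $X$ as consecutive steps in $P$. *)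

theory Defs
  imports Main
begin

datatype step = U | D | F

fun rise :: "step \<Rightarrow> int" where
  "rise U = 1"
| "rise D = -1"
| "rise F = 0"

definition altitude :: "step list \<Rightarrow> int" where
  "altitude P = sum_list (map rise P)"

definition motzkin :: "nat \<Rightarrow> step list set" where
  "motzkin n = {P. length P = n \<and> altitude P = 0 \<and> (\<forall>i\<le>length P. 0 \<le> altitude (take i P))}"

definition dyck :: "nat \<Rightarrow> step list set" where
  "dyck n = {P \<in> motzkin (2 * n). F \<notin> set P}"

definition is_dyck :: "step list \<Rightarrow> bool" where
  "is_dyck P \<longleftrightarrow> (\<exists>n. P \<in> dyck n)"

definition height :: "step list \<Rightarrow> int" where
  "height P = Max ((\<lambda>i. altitude (take i P)) ` {..length P})"

inductive_set Dh :: "step list set" where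
  Dh_empty: "[] \<in> Dh"
| Dh_step: "\<alpha> \<in> Dh \<Longrightarrow> \<beta> \<in> Dh \<Longrightarrow> height (U # \<alpha> @ [D]) \<ge> height \<beta> \<Longrightarrow> U # \<alpha> @ D # \<beta> \<in> Dh"

definition Dh_n :: "nat \<Rightarrow> step list set" where
  "Dh_n n = {P \<in> Dh. length P = 2 * n}"

definition occurrences :: "step list \<Rightarrow> step list \<Rightarrow> nat" where
  "occurrences X P =
     card {i. i + length X \<le> length P \<and> take (length X) (drop i P) = X}"

lemma altitude_simps [simp]:
  "altitude [] = 0"
  "altitude (x # P) = rise x + altitude P"
  "altitude (P @ Q) = altitude P + altitude Q"
  by (simp_all add: altitude_def)

lemma prefixes_nonneg_iff:
  "(\<forall>i\<le>length P. 0 \<le> altitude (take i P)) \<longleftrightarrow> (\<forall>A B. P = A @ B \<longrightarrow> 0 \<le> altitude A)"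
  (is "?l \<longleftrightarrow> ?r")
proof
  assume l: ?l
  show ?r
  proof (intro allI impI)
    fix A B assume "P = A @ B"
    then show "0 \<le> altitude A" using l[rule_format, of "length A"] by simp
  qed
next
  assume ?r
  then show ?l by (metis append_take_drop_id)
qed

lemma motzkin_iff:
  "P \<in> motzkin n \<longleftrightarrow>
     length P = n \<and> altitude P = 0 \<and> (\<forall>A B. P = A @ B \<longrightarrow> 0 \<le> altitude A)"
  by (simp only: motzkin_def prefixes_nonneg_iff mem_Collect_eq)

lemma is_dyck_iff:
  "is_dyck P \<longleftrightarrow>
     altitude P = 0 \<and> (\<forall>A B. P = A @ B \<longrightarrow> 0 \<le> altitude A) \<and> F \<notin> set P"
proof -
  have par: "even (int (length Q) + altitude Q)" if "F \<notin> set Q" for Q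
    using that
  proof (induction Q)
    case (Cons x Q)
    then show ?case by (cases x) auto
  qed simp
  have "\<exists>n. length P = 2 * n" if "F \<notin> set P" "altitude P = 0"
    using par[OF that(1)] that(2) by (auto elim: evenE)
  then show ?thesis
    unfolding is_dyck_def dyck_def mem_Collect_eq motzkin_iff by blast
qed

lemma is_dyck_Nil [simp]: "is_dyck []"
  by (simp add: is_dyck_iff)

lemma is_dyck_altitude: "is_dyck P \<Longrightarrow> altitude P = 0"
  by (simp add: is_dyck_iff)

lemma is_dyck_prefix: "is_dyck (A @ B) \<Longrightarrow> 0 \<le> altitude A"
  by (auto simp: is_dyck_iff)

lemma first_return_unique:
  assumes d: "is_dyck \<beta>" "is_dyck \<beta>'"
    and eq: "\<beta> @ D # \<gamma> = \<beta>' @ D # \<gamma>'"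
  shows "\<beta> = \<beta>' \<and> \<gamma> = \<gamma>'"
proof -
  have "X = X' \<and> Y = Y'"
    if dX: "is_dyck X" "is_dyck X'" and e: "X @ D # Y = X' @ D # Y'" and "length X \<le> length X'"
    for X X' Y Y'
  proof -
    obtain Z where Z: "X' = X @ Z" "D # Y = Z @ D # Y'"
      using e \<open>length X \<le> length X'\<close> by (auto simp: append_eq_append_conv2)
    show ?thesis
    proof (cases Z)
      case Nil
      then show ?thesis using Z by simp
    next
      case (Cons z W)
      then have "X' = (X @ [D]) @ W" using Z by simp
      then have "0 \<le> altitude (X @ [D])" using dX(2) is_dyck_prefix by metis
      then show ?thesis using is_dyck_altitude[OF dX(1)] by simp
    qed
  qed
  from this[OF d eq] this[OF d(2,1) eq[symmetric]] show ?thesis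
    by (metis nat_le_linear)
qed

lemma last_return_unique:
  assumes d: "is_dyck \<alpha>" "is_dyck \<alpha>'" "is_dyck \<delta>" "is_dyck \<delta>'"
    and eq: "\<alpha> @ U # \<delta> @ [D] = \<alpha>' @ U # \<delta>' @ [D]"
  shows "\<alpha> = \<alpha>' \<and> \<delta> = \<delta>'"
proof -
  have "X = X' \<and> Y = Y'"
    if dX: "is_dyck X" "is_dyck X'" "is_dyck Y" and e: "X @ U # Y @ [D] = X' @ U # Y' @ [D]"
      and "length X \<le> length X'"
    for X X' Y Y'
  proof -
    obtain Z where Z: "X' = X @ Z" "U # Y @ [D] = Z @ U # Y' @ [D]"
      using e \<open>length X \<le> length X'\<close> by (auto simp: append_eq_append_conv2)
    show ?thesis
    proof (cases Z)
      case Nil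
      then show ?thesis using Z by simp
    next
      case (Cons z W)
      then have z: "z = U" and "Y @ [D] = (W @ U # Y') @ [D]" using Z by auto
      then have "Y = W @ U # Y'" by blast
      then have "0 \<le> altitude W" using dX(3) is_dyck_prefix by metis
      then show ?thesis
        using is_dyck_altitude[OF dX(1)] is_dyck_altitude[OF dX(2)] Z Cons z by simp
    qed
  qed
  from this[OF d(1,2,3) eq] this[OF d(2,1,4) eq[symmetric]] show ?thesis
    by (metis nat_le_linear)
qed

lemma first_return_exists:
  assumes P: "is_dyck P" "P \<noteq> []"
  obtains \<beta> \<gamma> where "is_dyck \<beta>" "is_dyck \<gamma>" "P = U # \<beta> @ D # \<gamma>"
proof -
  define Q where "Q j \<longleftrightarrow> 0 < j \<and> j \<le> length P \<and> altitude (take j P) = 0" for j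
  have "Q (length P)" using P by (simp add: Q_def is_dyck_altitude)
  then obtain j where j: "Q j" and min: "\<And>i. i < j \<Longrightarrow> \<not> Q i"
    by (metis exists_least_iff)
  obtain x R where xR: "take j P = x # R" using j P(2) by (cases "take j P") (auto simp: Q_def)
  define \<gamma> where "\<gamma> = drop j P"
  have Pj: "P = x # R @ \<gamma>" using xR append_take_drop_id[of j P] by (simp add: \<gamma>_def)
  have nF: "F \<notin> set P" using P by (simp add: is_dyck_iff)
  have "0 \<le> altitude [x]" using P(1) is_dyck_prefix[of "[x]" "R @ \<gamma>"] Pj by simp
  then have x: "x = U" using nF Pj by (cases x) auto
  have alt0: "altitude (x # R) = 0" using j xR by (simp add: Q_def)
  then have "R \<noteq> []" using x by auto
  then obtain \<beta> y where R: "R = \<beta> @ [y]" by (cases R rule: rev_cases) auto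
  have lenj: "j = length R + 1" using j xR by (metis Q_def Suc_eq_plus1 length_Cons length_take min.absorb2)
  have pre: "0 \<le> altitude A" if "\<beta> = A @ B" for A B
  proof -
    have eqP: "P = (U # A) @ (B @ y # \<gamma>)" using Pj x R that by simp
    have "0 \<le> altitude (U # A)" using P(1) is_dyck_prefix eqP by metis
    moreover have "\<not> Q (length (U # A))" using min lenj R that by simp
    then have "altitude (U # A) \<noteq> 0" unfolding Q_def using eqP by auto
    ultimately show ?thesis by simp
  qed
  have b: "0 \<le> altitude \<beta>" using pre[of \<beta> "[]"] by simp
  then have y: "y = D" using alt0 x R nF Pj by (cases y) auto
  have "is_dyck \<beta>" using pre nF Pj R alt0 x y by (auto simp: is_dyck_iff)
  moreover have "is_dyck \<gamma>"
  proof -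
    have "0 \<le> altitude A" if "\<gamma> = A @ B" for A B
      using is_dyck_prefix[of "(x # R) @ A" B] P(1) Pj that alt0 by simp
    then show ?thesis using nF Pj alt0 is_dyck_altitude[OF P(1)] by (auto simp: is_dyck_iff)
  qed
  ultimately show ?thesis using that Pj x R y by simp
qed

lemma last_return_exists:
  assumes "is_dyck P" "P \<noteq> []"
  shows "\<exists>\<alpha> \<delta>. is_dyck \<alpha> \<and> is_dyck \<delta> \<and> P = \<alpha> @ U # \<delta> @ [D]"
  using assms
proof (induction "length P" arbitrary: P rule: less_induct)
  case less
  obtain \<beta> \<gamma> where bg: "is_dyck \<beta>" "is_dyck \<gamma>" "P = U # \<beta> @ D # \<gamma>"
    using first_return_exists less.prems by metis
  show ?case
  proof (cases "\<gamma> = []")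
    case True
    then show ?thesis using bg by (intro exI[of _ "[]"] exI[of _ \<beta>]) simp
  next
    case False
    then obtain \<alpha> \<delta> where ad: "is_dyck \<alpha>" "is_dyck \<delta>" "\<gamma> = \<alpha> @ U # \<delta> @ [D]"
      using less.hyps[of \<gamma>] bg by auto
    have Pe: "P = (U # \<beta> @ D # \<alpha>) @ U # \<delta> @ [D]" using bg ad by simp
    have "0 \<le> altitude A" if "U # \<beta> @ D # \<alpha> = A @ B" for A B
      using is_dyck_prefix[of A "B @ U # \<delta> @ [D]"] less.prems(1) Pe that by simp
    then have "is_dyck (U # \<beta> @ D # \<alpha>)"
      using ad(1) bg(1) by (auto simp: is_dyck_iff)
    then show ?thesis using Pe ad(2) by blast
  qed
qed

lemma motzkin_append:
  "A \<in> motzkin m \<Longrightarrow> B \<in> motzkin n \<Longrightarrow> A @ B \<in> motzkin (m + n)"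
  by (auto simp: motzkin_iff append_eq_append_conv2)

lemma motzkin_elevate:
  assumes "A \<in> motzkin n"
  shows "U # A @ [D] \<in> motzkin (n + 2)"
proof -
  have A: "length A = n" "altitude A = 0" "\<And>X Y. A = X @ Y \<Longrightarrow> 0 \<le> altitude X"
    using assms by (auto simp: motzkin_iff)
  have "0 \<le> altitude X" if "U # A @ [D] = X @ Y" for X Y
  proof (cases X)
    case (Cons x X')
    then have x: "x = U" and e: "A @ [D] = X' @ Y" using that by auto
    show ?thesis
    proof (cases Y rule: rev_cases)
      case Nil
      then have "X' = A @ [D]" using e by simp
      then show ?thesis using A(2) Cons x by simp
    next
      case (snoc Y' y)
      then have "A = X' @ Y'" using e by simp
      then show ?thesis using A(3)[of X' Y'] Cons x by simp
    qed
  qed simp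
  then show ?thesis using A(1,2) by (auto simp: motzkin_iff)
qed

lemma is_dyck_motzkin: "is_dyck P \<longleftrightarrow> P \<in> motzkin (length P) \<and> F \<notin> set P"
  by (simp add: is_dyck_iff motzkin_iff)

lemma is_dyck_append: "is_dyck P \<Longrightarrow> is_dyck Q \<Longrightarrow> is_dyck (P @ Q)"
  using motzkin_append[of P "length P" Q "length Q"] by (simp add: is_dyck_motzkin)

lemma is_dyck_elevate: "is_dyck P \<Longrightarrow> is_dyck (U # P @ [D])"
  using motzkin_elevate[of P "length P"] by (simp add: is_dyck_motzkin)

lemma Dh_is_dyck: "P \<in> Dh \<Longrightarrow> is_dyck P"
proof (induction rule: Dh.induct)
  case (Dh_step \<alpha> \<beta>)
  then show ?case using is_dyck_append[OF is_dyck_elevate, of \<alpha> \<beta>] by simp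
qed simp

lemma is_dyck_last_flat:
  assumes "is_dyck \<alpha>"
  shows "is_dyck (\<alpha> @ [U, D])"
  using is_dyck_append[OF assms is_dyck_elevate[OF is_dyck_Nil]] by simp

lemma is_dyck_inner:
  assumes "is_dyck \<beta>" "is_dyck \<gamma>"
  shows "is_dyck (U # \<beta> @ D # \<gamma>)"
  using is_dyck_append[OF is_dyck_elevate[OF assms(1)] assms(2)] by simp

lemma is_dyck_last_up:
  assumes "is_dyck \<alpha>" "is_dyck \<beta>" "is_dyck \<gamma>"
  shows "is_dyck (\<alpha> @ [U, U] @ \<beta> @ [D] @ \<gamma> @ [D])"
  using is_dyck_append[OF assms(1) is_dyck_elevate[OF is_dyck_inner[OF assms(2,3)]]] by simp

lemma last_flat_neq_last_up:
  assumes "is_dyck \<alpha>" "is_dyck \<alpha>'" "is_dyck \<beta>" "is_dyck \<gamma>"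
  shows "\<alpha> @ [U, D] \<noteq> \<alpha>' @ [U, U] @ \<beta> @ [D] @ \<gamma> @ [D]"
  using last_return_unique[OF assms(1,2) is_dyck_Nil is_dyck_inner[OF assms(3,4)]] by auto

lemma last_up_unique:
  assumes "is_dyck \<alpha>" "is_dyck \<beta>" "is_dyck \<gamma>" "is_dyck \<alpha>'" "is_dyck \<beta>'" "is_dyck \<gamma>'"
    and "\<alpha> @ [U, U] @ \<beta> @ [D] @ \<gamma> @ [D] = \<alpha>' @ [U, U] @ \<beta>' @ [D] @ \<gamma>' @ [D]"
  shows "\<alpha> = \<alpha>' \<and> \<beta> = \<beta>' \<and> \<gamma> = \<gamma>'"
proof -
  have "\<alpha> = \<alpha>' \<and> U # \<beta> @ D # \<gamma> = U # \<beta>' @ D # \<gamma>'"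
    using last_return_unique[OF assms(1,4) is_dyck_inner[OF assms(2,3)] is_dyck_inner[OF assms(5,6)]]
      assms(7) by simp
  then show ?thesis using first_return_unique[OF assms(2,5), of \<gamma> \<gamma>'] by simp
qed

text \<open>
  The recursion is stated for all Dyck paths: by the last return decomposition each nonempty one
  has exactly one of the two forms below. If the argument is in \<^const>\<open>Dh\<close>, so are
  \<open>\<alpha>\<close>, \<open>\<beta>\<close> and \<open>\<gamma>\<close>, so the restriction to \<^const>\<open>Dh\<close> is the intended map.
  The last equation is a dummy value outside the Dyck paths.
\<close>

function phi :: "step list \<Rightarrow> step list" where
  "phi [] = []"
| "is_dyck \<alpha> \<Longrightarrow> phi (\<alpha> @ [U, D]) = phi \<alpha> @ [F]"
| "is_dyck \<alpha> \<Longrightarrow> is_dyck \<beta> \<Longrightarrow> is_dyck \<gamma> \<Longrightarrow>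
     phi (\<alpha> @ [U, U] @ \<beta> @ [D] @ \<gamma> @ [D]) = phi \<alpha> @ phi \<gamma> @ [U] @ phi \<beta> @ [D]"
| "\<not> is_dyck P \<Longrightarrow> phi P = undefined"
proof -
  show thesis
    if nil: "P = [] \<Longrightarrow> thesis"
      and flat: "\<And>\<alpha>. is_dyck \<alpha> \<Longrightarrow> P = \<alpha> @ [U, D] \<Longrightarrow> thesis"
      and up: "\<And>\<alpha> \<beta> \<gamma>. is_dyck \<alpha> \<Longrightarrow> is_dyck \<beta> \<Longrightarrow> is_dyck \<gamma> \<Longrightarrow>
        P = \<alpha> @ [U, U] @ \<beta> @ [D] @ \<gamma> @ [D] \<Longrightarrow> thesis"
      and other: "\<And>Q. \<not> is_dyck Q \<Longrightarrow> P = Q \<Longrightarrow> thesis"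
    for thesis P
  proof (cases "is_dyck P \<and> P \<noteq> []")
    case True
    then obtain \<alpha> \<delta> where ad: "is_dyck \<alpha>" "is_dyck \<delta>" "P = \<alpha> @ U # \<delta> @ [D]"
      using last_return_exists by blast
    show thesis
    proof (cases "\<delta> = []")
      case True
      then show ?thesis using flat ad by simp
    next
      case False
      then obtain \<beta> \<gamma> where "is_dyck \<beta>" "is_dyck \<gamma>" "\<delta> = U # \<beta> @ D # \<gamma>"
        using first_return_exists ad(2) by metis
      then show ?thesis using up ad by simp
    qed
  next
    case False
    then show ?thesis using nil other by blast
  qed
next
  show "phi_sumC \<alpha> @ phi_sumC \<gamma> @ [U] @ phi_sumC \<beta> @ [D] =
      phi_sumC \<alpha>' @ phi_sumC \<gamma>' @ [U] @ phi_sumC \<beta>' @ [D]"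
    if "is_dyck \<alpha>" "is_dyck \<beta>" "is_dyck \<gamma>" "is_dyck \<alpha>'" "is_dyck \<beta>'" "is_dyck \<gamma>'"
      "\<alpha> @ [U, U] @ \<beta> @ [D] @ \<gamma> @ [D] = \<alpha>' @ [U, U] @ \<beta>' @ [D] @ \<gamma>' @ [D]"
    for \<alpha> \<beta> \<gamma> \<alpha>' \<beta>' \<gamma>'
    using last_up_unique[OF that] by simp
next
  show "phi_sumC \<alpha> @ [F] = phi_sumC \<alpha>' @ phi_sumC \<gamma> @ [U] @ phi_sumC \<beta> @ [D]"
    if "is_dyck \<alpha>" "is_dyck \<alpha>'" "is_dyck \<beta>" "is_dyck \<gamma>"
      "\<alpha> @ [U, D] = \<alpha>' @ [U, U] @ \<beta> @ [D] @ \<gamma> @ [D]"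
    for \<alpha> \<alpha>' \<beta> \<gamma>
    using last_flat_neq_last_up[OF that(1-4)] that(5) by blast
next
  show "phi_sumC \<alpha> @ phi_sumC \<gamma> @ [U] @ phi_sumC \<beta> @ [D] = undefined"
    if "is_dyck \<alpha>" "is_dyck \<beta>" "is_dyck \<gamma>" "\<not> is_dyck P"
      "\<alpha> @ [U, U] @ \<beta> @ [D] @ \<gamma> @ [D] = P"
    for \<alpha> \<beta> \<gamma> P
    using is_dyck_last_up[OF that(1-3)] that(4,5) by blast
next
  show "phi_sumC \<alpha> @ [F] = undefined"
    if "is_dyck \<alpha>" "\<not> is_dyck P" "\<alpha> @ [U, D] = P" for \<alpha> P
    using is_dyck_last_flat[OF that(1)] that(2,3) by blast
qed auto
termination by (relation "measure length") auto

lemma phi_in_motzkin: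
  "is_dyck P \<Longrightarrow> length P = 2 * n \<Longrightarrow> phi P \<in> motzkin n"
proof (induction P arbitrary: n rule: phi.induct)
  case 1
  then show ?case by (simp add: motzkin_iff)
next
  case (2 \<alpha>)
  have "[F] \<in> motzkin 1" by (auto simp: motzkin_iff Cons_eq_append_conv)
  moreover have "phi \<alpha> \<in> motzkin (n - 1)" using 2 by auto
  ultimately show ?case using 2 motzkin_append[of "phi \<alpha>" "n - 1" "[F]" 1] by auto
next
  case (3 \<alpha> \<beta> \<gamma>)
  obtain a b c where len: "length \<alpha> = 2 * a" "length \<beta> = 2 * b" "length \<gamma> = 2 * c"
    using 3(1-3) by (auto simp: is_dyck_def dyck_def motzkin_def)
  then have n: "n = a + (c + (b + 2))" using 3(8) by simp
  have "phi \<alpha> \<in> motzkin a" "phi \<beta> \<in> motzkin b" "phi \<gamma> \<in> motzkin c"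
    using 3(1-6) len by blast+
  then have "phi \<alpha> @ phi \<gamma> @ U # phi \<beta> @ [D] \<in> motzkin n"
    unfolding n by (intro motzkin_append motzkin_elevate)
  then show ?case using phi.simps(3)[OF 3(1-3)] by simp
qed simp

end

theory Submission
  imports Defs "HOL-Library.Sublist"
begin

text \<open>
  Components of a path in \<^const>\<open>Dh\<close> have weakly decreasing heights. Hence in
  \<open>P = \<alpha> U U \<beta> D \<gamma> D\<close> the prefix \<open>\<alpha>\<close> is empty or ends in \<open>DD\<close>, and
  \<open>\<gamma>\<close> can end in \<open>DD\<close> only if \<open>\<beta>\<close> is nonempty. Moreover \<open>\<phi>\<close>
  sends paths ending in \<open>UD\<close> to paths ending in \<open>F\<close>, and paths ending in \<open>DD\<close> to
  paths ending in \<open>D\<close>. Along the recursion for \<open>\<phi>\<close> one compares the occurrences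
  straddling the junctions: both sides gain one if \<open>\<alpha>\<close> is nonempty (resp. ends in
  \<open>DD\<close>, if \<open>P = \<alpha> U D\<close>), and one more if \<open>\<beta>\<close> and \<open>\<gamma>\<close> are both nonempty.
\<close>

section \<open>Counting occurrences across a concatenation\<close>

lemma occurrences_Nil [simp]: "X \<noteq> [] \<Longrightarrow> occurrences X [] = 0"
  by (simp add: occurrences_def)

text \<open>Turns the cardinality into a recursion on the word, by splitting off position 0, so that
  the append rules follow by list induction.\<close>

lemma occurrences_Cons:
  assumes "X \<noteq> []"
  shows "occurrences X (p # P) = of_bool (prefix X (p # P)) + occurrences X P"
proof -
  let ?S = "\<lambda>P. {i. i + length X \<le> length P \<and> take (length X) (drop i P) = X}"
  have fin: "finite (?S P)"
    by (rule finite_subset[of _ "{..length P}"]) auto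
  have zero: "0 \<in> ?S (p # P) \<longleftrightarrow> prefix X (p # P)"
    using prefix_length_le[of X "p # P"] by (auto simp: prefix_def) (metis append_take_drop_id)
  have "?S (p # P) = (if prefix X (p # P) then {0} else {}) \<union> Suc ` ?S P" (is "_ = ?R")
  proof (rule set_eqI)
    fix i
    show "i \<in> ?S (p # P) \<longleftrightarrow> i \<in> ?R"
    proof (cases i)
      case 0
      then show ?thesis using zero by auto
    qed auto
  qed
  then show ?thesis
    unfolding occurrences_def using fin by (auto simp: card_image)
qed

lemma occurrences_append2:
  "occurrences [a, b] (P @ Q) =
    occurrences [a, b] P + occurrences [a, b] Q + of_bool (suffix [a] P \<and> prefix [b] Q)"
proof (induction P)
  case (Cons p P)
  then show ?case by (cases P) (auto simp: occurrences_Cons suffix_Cons)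
qed simp

lemma occurrences_append3:
  "occurrences [a, b, c] (P @ Q) =
    occurrences [a, b, c] P + occurrences [a, b, c] Q
    + of_bool (suffix [a, b] P \<and> prefix [c] Q) + of_bool (suffix [a] P \<and> prefix [b, c] Q)"
proof (induction P)
  case (Cons p P)
  consider "P = []" | x where "P = [x]" | x y R where "P = x # y # R"
    by (metis list.exhaust)
  then show ?case using Cons
    by cases (auto simp: occurrences_Cons suffix_Cons)
qed simp

section \<open>Heights and components of paths in \<open>Dh\<close>\<close>

lemma altitude_le_height: "altitude A \<le> height (A @ B)"
  unfolding height_def
  by (rule Max_ge) (auto intro!: image_eqI[of _ _ "length A"])

lemma height_le_append: "height A \<le> height (A @ B)"
proof -
  have "altitude (take i A) \<le> height (A @ B)" for i
    using altitude_le_height[of "take i A" "drop i A @ B"]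
    by (simp only: append_assoc[symmetric] append_take_drop_id)
  then show ?thesis unfolding height_def[of A] by (subst Max_le_iff) auto
qed

lemma dyck_ends_D:
  assumes "is_dyck P" "P \<noteq> []"
  shows "suffix [D] P"
  using last_return_exists[OF assms] by (auto simp: suffix_def)

text \<open>The path returns to altitude 0, so it stands at altitude 2 just before its final
  DD.\<close>

lemma two_le_height:
  assumes "is_dyck P" "suffix [D, D] P"
  shows "2 \<le> height P"
proof -
  obtain X where X: "P = X @ [D, D]" using assms(2) by (auto simp: suffix_def)
  then show ?thesis
    using is_dyck_altitude[OF assms(1)] altitude_le_height[of X "[D, D]"] by simp
qed

lemma height_UD: "height [U, D] = 1"
proof -
  have "{..length [U, D]} = {0, 1, 2}" by auto
  then show ?thesis by (simp add: height_def)
qed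

lemma elevate_ends_DD:
  assumes "is_dyck P" "P \<noteq> []"
  shows "suffix [D, D] (U # P @ [D])"
  using dyck_ends_D[OF assms] by (auto simp: suffix_def)

lemma Dh_Cons:
  assumes "U # \<beta> @ D # \<gamma> \<in> Dh" "is_dyck \<beta>"
  shows "\<beta> \<in> Dh \<and> \<gamma> \<in> Dh \<and> height \<gamma> \<le> height (U # \<beta> @ [D])"
  using assms(1)
proof cases
  case (Dh_step \<alpha> \<beta>')
  then show ?thesis
    using first_return_unique[OF assms(2) Dh_is_dyck[of \<alpha>]] by auto
qed

text \<open>Membership in \<open>Dh\<close> is defined by the first return, whereas
  \<open>phi\<close> recurses on the last one. Induction peels off the first component, which P and
  a nonempty \<alpha> share.\<close>

lemma Dh_last_return:
  assumes "P \<in> Dh" "P = \<alpha> @ U # \<delta> @ [D]" "is_dyck \<alpha>" "is_dyck \<delta>"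
  shows "\<alpha> \<in> Dh \<and> \<delta> \<in> Dh \<and> (\<delta> = [] \<or> \<alpha> = [] \<or> suffix [D, D] \<alpha>)"
  using assms
proof (induction arbitrary: \<alpha> rule: Dh.induct)
  case (Dh_step a b)
  show ?case
  proof (cases "\<alpha> = []")
    case True
    then have "\<delta> = a"
      using first_return_unique[OF Dh_step.prems(3) Dh_is_dyck[OF Dh_step.hyps(1)], of "[]" b]
        Dh_step.prems(1) by simp
    then show ?thesis using True Dh_step.hyps Dh_empty by simp
  next
    case False
    then obtain a' b' where ab: "is_dyck a'" "is_dyck b'" "\<alpha> = U # a' @ D # b'"
      using first_return_exists Dh_step.prems(2) by metis
    have eq: "a = a'" "b = b' @ U # \<delta> @ [D]"
      using first_return_unique[OF Dh_is_dyck[OF Dh_step.hyps(1)] ab(1), of b "b' @ U # \<delta> @ [D]"]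
        Dh_step.prems(1) ab(3) by simp_all
    have IH: "b' \<in> Dh" "\<delta> \<in> Dh" "\<delta> = [] \<or> b' = [] \<or> suffix [D, D] b'"
      using Dh_step.IH(2)[OF eq(2) ab(2) Dh_step.prems(3)] by auto
    \<comment> \<open>Deleting the last component cannot raise the height, so the height condition
      passes from b to b'.\<close>
    have "height b' \<le> height (U # a @ [D])"
      using height_le_append[of b' "U # \<delta> @ [D]"] Dh_step.hyps(3) eq(2) by simp
    then have "\<alpha> \<in> Dh"
      using Dh.Dh_step[OF Dh_step.hyps(1) IH(1)] ab eq by simp
    moreover have "suffix [D, D] \<alpha>" if "\<delta> \<noteq> []"
    \<comment> \<open>If b' is empty, then b is the single component U \<delta> D, of height at
      least 2. The first component is at least as high, so it is not UD and ends in DD.\<close>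
    proof (cases "b' = []")
      case True
      have "is_dyck b" using Dh_is_dyck[OF Dh_step.hyps(2)] .
      moreover have "suffix [D, D] b"
        using elevate_ends_DD[OF Dh_step.prems(3) that] eq(2) True by simp
      ultimately have "2 \<le> height (U # a @ [D])"
        using two_le_height Dh_step.hyps(3) by force
      then have "a \<noteq> []" using height_UD by auto
      then show ?thesis
        using elevate_ends_DD[OF ab(1)] ab(3) eq(1) True by simp
    next
      case False
      then show ?thesis using IH(3) that ab(3) by (auto simp: suffix_def)
    qed
    ultimately show ?thesis using IH by blast
  qed
qed simp

section \<open>First and last steps of \<open>phi P\<close>\<close>

lemma phi_starts:
  assumes "is_dyck P"
  shows "\<not> prefix [D] (phi P)"
proof
  assume "prefix [D] (phi P)"
  then obtain R where R: "phi P = [D] @ R" by (auto simp: prefix_def)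
  obtain n where "length P = 2 * n"
    using assms by (auto simp: is_dyck_def dyck_def motzkin_def)
  then have "phi P \<in> motzkin n" using phi_in_motzkin assms by blast
  then have "0 \<le> altitude [D]" using R unfolding motzkin_iff by blast
  then show False by simp
qed

text \<open>The two recursive equations of \<open>phi\<close> append F to the image of a path ending
  in UD and D to that of a path ending in DD.\<close>

lemma phi_ends:
  assumes "is_dyck P" "P \<noteq> []"
  shows "suffix [U, D] P \<and> suffix [F] (phi P) \<or> suffix [D, D] P \<and> suffix [D] (phi P)"
proof -
  obtain \<alpha> \<delta> where ad: "is_dyck \<alpha>" "is_dyck \<delta>" "P = \<alpha> @ U # \<delta> @ [D]"
    using last_return_exists[OF assms] by blast
  show ?thesis
  proof (cases "\<delta> = []")
    case True
    then show ?thesis using ad phi.simps(2)[OF ad(1)] by (simp add: suffix_def)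
  next
    case False
    then obtain \<beta> \<gamma> where bg: "is_dyck \<beta>" "is_dyck \<gamma>" "\<delta> = U # \<beta> @ D # \<gamma>"
      using first_return_exists ad(2) by metis
    have "suffix [D] (phi P)"
      using phi.simps(3)[OF ad(1) bg(1,2)] ad(3) bg(3) by (simp add: suffix_def)
    moreover have "suffix [D, D] P"
      using elevate_ends_DD[OF ad(2) False] ad(3) by (auto simp: suffix_def)
    ultimately show ?thesis by simp
  qed
qed

lemma phi_eq_Nil: "is_dyck P \<Longrightarrow> phi P = [] \<longleftrightarrow> P = []"
  using phi_ends[of P] by (cases "P = []") auto

lemma dyck_starts_U: "is_dyck P \<Longrightarrow> P \<noteq> [] \<Longrightarrow> prefix [U] P"
  by (metis first_return_exists Cons_prefix_Cons Nil_prefix)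


section \<open>Matching the counts at the junctions\<close>

definition motzkin_count :: "step list \<Rightarrow> nat" where
  "motzkin_count Q = occurrences [D, F] Q + occurrences [D, U] Q
    + occurrences [F, U, U] Q + occurrences [F, U, F] Q"

text \<open>After D, and likewise after FU, every letter except D completes exactly one counted
  word. The four words therefore merge in pairs.\<close>

lemma motzkin_count_append:
  "motzkin_count (A @ B) = motzkin_count A + motzkin_count B
    + of_bool (suffix [D] A \<and> B \<noteq> [] \<and> \<not> prefix [D] B)
    + of_bool (suffix [F] A \<and> (prefix [U, U] B \<or> prefix [U, F] B))
    + of_bool (suffix [F, U] A \<and> B \<noteq> [] \<and> \<not> prefix [D] B)"
proof (cases B)
  case (Cons b B')
  then show ?thesis
    by (cases b; cases B')
      (auto simp: motzkin_count_def occurrences_append2 occurrences_append3)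
qed (simp add: motzkin_count_def)

lemma motzkin_count_singleton [simp]: "motzkin_count [x] = 0"
  by (simp add: motzkin_count_def occurrences_Cons)

text \<open>A new DDU either starts with a final DD of \<alpha>, or consists of the last D of
  \<beta>, the D after it and the first U of \<gamma>.\<close>

lemma occurrences_DDU_last_up:
  assumes "is_dyck \<beta>" "is_dyck \<gamma>"
  shows "occurrences [D, D, U] (\<alpha> @ [U, U] @ \<beta> @ [D] @ \<gamma> @ [D]) =
    occurrences [D, D, U] \<alpha> + occurrences [D, D, U] \<beta> + occurrences [D, D, U] \<gamma>
    + of_bool (suffix [D, D] \<alpha>) + of_bool (\<beta> \<noteq> [] \<and> \<gamma> \<noteq> [])"
proof -
  have "suffix [D] \<beta> \<longleftrightarrow> \<beta> \<noteq> []" using dyck_ends_D[OF assms(1)] by auto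
  moreover have "prefix [U] (\<gamma> @ [D]) \<longleftrightarrow> \<gamma> \<noteq> []" "\<not> prefix [D, U] (\<gamma> @ [D])"
    using dyck_starts_U[OF assms(2)] by (cases \<gamma>; auto)+
  ultimately show ?thesis
    by (simp add: occurrences_append3 occurrences_Cons suffix_Cons)
qed

text \<open>Here \<alpha>, \<beta>, \<gamma> stand for the images under \<open>phi\<close>. The
  hypotheses record what is known of their ends, so the junction count needs no Dyck paths.\<close>

lemma motzkin_count_last_up:
  assumes "\<alpha> = [] \<or> suffix [D] \<alpha>" "\<gamma> = [] \<or> suffix [D] \<gamma> \<or> suffix [F] \<gamma>"
    and "suffix [D] \<gamma> \<Longrightarrow> \<beta> \<noteq> []" "\<not> prefix [D] \<beta>" "\<not> prefix [D] \<gamma>"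
  shows "motzkin_count (\<alpha> @ \<gamma> @ [U] @ \<beta> @ [D]) =
    motzkin_count \<alpha> + motzkin_count \<beta> + motzkin_count \<gamma>
    + of_bool (\<alpha> \<noteq> []) + of_bool (\<beta> \<noteq> [] \<and> \<gamma> \<noteq> [])"
proof -
  have ends: "\<not> (suffix [x] Q \<and> suffix [y] Q)" if "x \<noteq> y" for x y :: step and Q
    using that by (auto simp: suffix_def)
  have "\<not> suffix [F] \<alpha>" "\<not> suffix [F, U] \<alpha>"
    using assms(1) by (auto simp: suffix_def)
  moreover have "suffix [D] \<alpha> \<longleftrightarrow> \<alpha> \<noteq> []" using assms(1) by auto
  moreover have "prefix [D] (\<gamma> @ [U] @ \<beta> @ [D]) \<longleftrightarrow> False"
    using assms(5) by (cases \<gamma>) auto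
  ultimately have 1: "motzkin_count (\<alpha> @ \<gamma> @ [U] @ \<beta> @ [D]) =
      motzkin_count \<alpha> + motzkin_count (\<gamma> @ [U] @ \<beta> @ [D]) + of_bool (\<alpha> \<noteq> [])"
    by (simp add: motzkin_count_append[of \<alpha>])
  \<comment> \<open>No counted word begins with U or ends in D.\<close>
  have U: "motzkin_count ([U] @ \<beta> @ [D]) = motzkin_count \<beta>"
    by (subst motzkin_count_append, subst motzkin_count_append) (simp add: suffix_Cons)
  have "\<not> suffix [F, U] \<gamma>" using assms(2) by (auto simp: suffix_def)
  moreover have "prefix [U, U] ([U] @ \<beta> @ [D]) \<or> prefix [U, F] ([U] @ \<beta> @ [D]) \<longleftrightarrow> \<beta> \<noteq> []"
  proof (cases \<beta>)
    case (Cons b B)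
    then show ?thesis using assms(4) by (cases b) auto
  qed simp
  ultimately have "motzkin_count (\<gamma> @ [U] @ \<beta> @ [D]) =
      motzkin_count \<gamma> + motzkin_count \<beta> + of_bool (suffix [D] \<gamma>)
      + of_bool (suffix [F] \<gamma> \<and> \<beta> \<noteq> [])"
    using U by (simp add: motzkin_count_append[of \<gamma>])
  \<comment> \<open>A final D of \<gamma> gives DU and forces \<beta> to be nonempty; a final F
    gives FUU or FUF exactly when \<beta> is nonempty. Both cannot happen at once.\<close>
  moreover have "of_bool (suffix [D] \<gamma>) + of_bool (suffix [F] \<gamma> \<and> \<beta> \<noteq> []) =
      (of_bool (\<beta> \<noteq> [] \<and> \<gamma> \<noteq> []) :: nat)"
    using assms(2,3) ends[of D F \<gamma>] by auto
  ultimately show ?thesis using 1 by simp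
qed

lemma occurrences_DDU_phi:
  assumes "is_dyck P" "P \<in> Dh"
  shows "occurrences [D, D, U] P = motzkin_count (phi P)"
  using assms
proof (induction P rule: phi.induct)
  case 1
  then show ?case by (simp add: motzkin_count_def)
next
  case (2 \<alpha>)
  have "\<alpha> \<in> Dh" using Dh_last_return[OF 2(4), of \<alpha> "[]"] 2(1) by simp
  then have IH: "occurrences [D, D, U] \<alpha> = motzkin_count (phi \<alpha>)" using 2 by blast
  \<comment> \<open>Appending UD creates a DDU exactly when appending F to the image creates a DF;
    excluding a final FU rules out a new FUF.\<close>
  have "(suffix [D, D] \<alpha> \<longleftrightarrow> suffix [D] (phi \<alpha>)) \<and> \<not> suffix [F, U] (phi \<alpha>)"
    using phi_ends[OF 2(1)] by (cases "\<alpha> = []") (auto simp: suffix_def)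
  then show ?case
    unfolding phi.simps(2)[OF 2(1)]
    by (simp add: IH motzkin_count_append occurrences_append3 occurrences_Cons)
next
  case (3 \<alpha> \<beta> \<gamma>)
  note dyck = 3(1-3)
  have last: "\<alpha> \<in> Dh" "U # \<beta> @ D # \<gamma> \<in> Dh" "\<alpha> = [] \<or> suffix [D, D] \<alpha>"
    using Dh_last_return[OF 3(8), of \<alpha> "U # \<beta> @ D # \<gamma>"] dyck is_dyck_inner by auto
  have first: "\<beta> \<in> Dh" "\<gamma> \<in> Dh" "height \<gamma> \<le> height (U # \<beta> @ [D])"
    using Dh_Cons[OF last(2) dyck(2)] by auto
  have \<alpha>: "\<alpha> = [] \<or> suffix [D] (phi \<alpha>)"
    using last(3) phi_ends[OF dyck(1)] by (auto simp: suffix_def)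
  have \<gamma>: "\<gamma> = [] \<or> suffix [D] (phi \<gamma>) \<or> suffix [F] (phi \<gamma>)"
    using phi_ends[OF dyck(3)] by auto
  \<comment> \<open>This is where the height condition enters: such a \<gamma> has height at least
    2, whereas U \<beta> D with \<beta> empty has height 1.\<close>
  have "\<beta> \<noteq> []" if "suffix [D] (phi \<gamma>)"
  proof -
    have "suffix [D, D] \<gamma>"
      using phi_ends[OF dyck(3)] that by (cases "\<gamma> = []") (auto simp: suffix_def)
    then have "2 \<le> height (U # \<beta> @ [D])" using two_le_height[OF dyck(3)] first(3) by simp
    then show ?thesis using height_UD by auto
  qed
  then have "motzkin_count (phi \<alpha> @ phi \<gamma> @ [U] @ phi \<beta> @ [D]) =
      motzkin_count (phi \<alpha>) + motzkin_count (phi \<beta>) + motzkin_count (phi \<gamma>)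
      + of_bool (\<alpha> \<noteq> []) + of_bool (\<beta> \<noteq> [] \<and> \<gamma> \<noteq> [])"
    using motzkin_count_last_up[of "phi \<alpha>" "phi \<gamma>" "phi \<beta>"] \<alpha> \<gamma> dyck
    by (simp add: phi_eq_Nil phi_starts)
  moreover have "suffix [D, D] \<alpha> \<longleftrightarrow> \<alpha> \<noteq> []" using last(3) by auto
  ultimately show ?case
    unfolding phi.simps(3)[OF dyck] occurrences_DDU_last_up[OF dyck(2,3)]
    using 3(4-6) dyck last(1) first(1,2) by simp
qed simp

theorem theorem10:
  fixes n :: nat and P :: "step list"
  assumes "P \<in> Dh_n n"
  shows "occurrences [D, D, U] P =
    occurrences [D, F] (phi P) + occurrences [D, U] (phi P)
    + occurrences [F, U, U] (phi P) + occurrences [F, U, F] (phi P)"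
  using assms occurrences_DDU_phi[of P] Dh_is_dyck[of P]
  by (simp add: Dh_n_def motzkin_count_def)

end
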